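(* There is no hyperhyperdark ceer all of whose equivalence classes are finite. Equivalently, every ceer all of whose equivalence classes are finite has an infinite transversal which is not hyperhyperimmune.
   Context: A ceer is a computably enumerable equivalence relation on $\omega$; it is infinite if it has infinitely many equivalence classes. A transversal of an equivalence relation $R$ is a set $T\subseteq\omega$ whose distinct elements are pairwise $R$-inequivalent. A weak disjoint array is a sequence $(W_{f(n)})_{n\in\omega}$ of pairwise disjoint finite sets given by c.e.\ indices, with $f$ computable; an infinite set is hyperhyperimmune if no weak disjoint array has every member meeting it. A ceer is hyperhyperdark if it is infinite and all of its infinite transversals are hyperhyperimmune. *)

theory Defs
  imports Main "HOL-Library.Nat_Bijection"
begin

text \<open>Kleene's partial recursive functions. Arities are not tracked in the syntax:
  a term applied to an argument list of unsuitable length is either undefined or ignores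
  the surplus arguments, so no non-computable function arises this way.\<close>

datatype recf =
    Zero
  | Succ
  | Proj nat
  | Comp recf "recf list"
  | Prec recf recf
  | Mu recf

text \<open>\<^term>\<open>None\<close> means divergence. In particular a composition diverges as soon as one of
  the inner functions does, and minimisation diverges unless all values below the least
  zero are defined.\<close>

fun eval :: "recf \<Rightarrow> nat list \<Rightarrow> nat option" where
  "eval Zero xs = Some 0"
| "eval Succ xs = (case xs of [] \<Rightarrow> None | x # _ \<Rightarrow> Some (Suc x))"
| "eval (Proj i) xs = (if i < length xs then Some (xs ! i) else None)"
| "eval (Comp f gs) xs = Option.bind (those (map (\<lambda>g. eval g xs) gs)) (\<lambda>ys. eval f ys)"
| "eval (Prec f g) xs =
     (case xs of
        [] \<Rightarrow> None
      | n # ys \<Rightarrow> rec_nat (eval f ys) (\<lambda>k r. Option.bind r (\<lambda>v. eval g (k # v # ys))) n)"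
| "eval (Mu f) xs =
     (if \<exists>n. eval f (n # xs) = Some 0 \<and> (\<forall>k<n. eval f (k # xs) \<noteq> None)
      then Some (LEAST n. eval f (n # xs) = Some 0)
      else None)"

primrec encode :: "recf \<Rightarrow> nat" where
  "encode Zero = prod_encode (0, 0)"
| "encode Succ = prod_encode (1, 0)"
| "encode (Proj i) = prod_encode (2, i)"
| "encode (Comp f gs) = prod_encode (3, prod_encode (encode f, list_encode (map encode gs)))"
| "encode (Prec f g) = prod_encode (4, prod_encode (encode f, encode g))"
| "encode (Mu f) = prod_encode (5, encode f)"

lemma encode_inject: "encode c = encode d \<Longrightarrow> c = d"
proof (induction c arbitrary: d)
  case (Comp f gs)
  then obtain f' gs' where d: "d = Comp f' gs'"
    by (cases d) auto
  with Comp.prems have eq: "encode f = encode f'" "map encode gs = map encode gs'"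
    by (auto dest: injD[OF inj_list_encode])
  have "gs = gs'"
    using eq(2) Comp.IH(2) by (intro list.inj_map_strong[of gs gs' encode encode]) auto
  with d eq(1) Comp.IH(1) show ?case by simp
qed (case_tac d; auto)+

text \<open>The c.e. set with index \<open>e\<close>, i.e. the domain of the unary partial recursive function
  with code \<open>e\<close>. By injectivity of \<^const>\<open>encode\<close> at most one term has code \<open>e\<close>;
  numbers that code no term are indices of the empty set.\<close>

definition W :: "nat \<Rightarrow> nat set" where
  "W e = {x. \<exists>c. encode c = e \<and> eval c [x] \<noteq> None}"

definition computable :: "(nat \<Rightarrow> nat) \<Rightarrow> bool" where
  "computable f \<longleftrightarrow> (\<exists>c. \<forall>n. eval c [n] = Some (f n))"

definition ce_rel :: "(nat \<times> nat) set \<Rightarrow> bool" where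
  "ce_rel R \<longleftrightarrow> (\<exists>c. R = {(x, y). eval c [x, y] \<noteq> None})"

definition ceer :: "(nat \<times> nat) set \<Rightarrow> bool" where
  "ceer R \<longleftrightarrow> equiv UNIV R \<and> ce_rel R"

definition transversal :: "(nat \<times> nat) set \<Rightarrow> nat set \<Rightarrow> bool" where
  "transversal R T \<longleftrightarrow> (\<forall>x\<in>T. \<forall>y\<in>T. x \<noteq> y \<longrightarrow> (x, y) \<notin> R)"

definition weak_disjoint_array :: "(nat \<Rightarrow> nat) \<Rightarrow> bool" where
  "weak_disjoint_array f \<longleftrightarrow>
     computable f \<and> (\<forall>n. finite (W (f n))) \<and> (\<forall>m n. m \<noteq> n \<longrightarrow> W (f m) \<inter> W (f n) = {})"

definition hyperhyperimmune :: "nat set \<Rightarrow> bool" where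
  "hyperhyperimmune A \<longleftrightarrow>
     infinite A \<and> \<not> (\<exists>f. weak_disjoint_array f \<and> (\<forall>n. W (f n) \<inter> A \<noteq> {}))"

definition hyperhyperdark :: "(nat \<times> nat) set \<Rightarrow> bool" where
  "hyperhyperdark R \<longleftrightarrow>
     ceer R \<and> infinite (UNIV // R) \<and>
     (\<forall>T. transversal R T \<and> infinite T \<longrightarrow> hyperhyperimmune T)"

end

theory Submission imports Defs begin

text \<open>Let \<open>V n\<close> be the set of those \<open>\<langle>n, k\<rangle>\<close> for which the first \<open>k\<close> elements of the column
  \<open>{\<langle>n, j\<rangle> | j}\<close> meet at most \<open>n\<close> equivalence classes. As \<open>R\<close> is c.e., these sets are uniformly
  c.e.; they are disjoint because the columns are. Since all classes are finite, a column meets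
  infinitely many classes, so \<open>V n\<close> is a finite initial segment of the column, and by maximality
  it meets more than \<open>n\<close> classes. Hence one can choose successively \<open>x n \<in> V n\<close> inequivalent to
  \<open>x 0, \<dots>, x (n - 1)\<close>, and the set of all \<open>x n\<close> is a transversal meeting every \<open>V n\<close>.\<close>

subsection \<open>Total recursive functions of fixed arity\<close>

definition total_recursive :: "nat \<Rightarrow> (nat list \<Rightarrow> nat) \<Rightarrow> bool" where
  "total_recursive m f \<longleftrightarrow> (\<exists>c. \<forall>xs. length xs = m \<longrightarrow> eval c xs = Some (f xs))"

definition total_recursive_vec :: "nat \<Rightarrow> nat \<Rightarrow> (nat list \<Rightarrow> nat list) \<Rightarrow> bool" where
  "total_recursive_vec m k A \<longleftrightarrow>
     (\<exists>cs. \<forall>xs. length xs = m \<longrightarrow>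
        length (A xs) = k \<and> those (map (\<lambda>c. eval c xs) cs) = Some (A xs))"

lemma those_eq_Some_iff: "those xs = Some ys \<longleftrightarrow> xs = map Some ys"
  by (induction xs arbitrary: ys) (auto split: option.splits simp: Cons_eq_map_conv)

lemma total_recursive_cong:
  assumes "total_recursive m f" "\<And>xs. length xs = m \<Longrightarrow> f xs = g xs"
  shows "total_recursive m g"
  using assms unfolding total_recursive_def by metis

lemma total_recursive_vec_Nil: "total_recursive_vec m 0 (\<lambda>_. [])"
  unfolding total_recursive_vec_def by (rule exI[of _ "[]"]) simp

lemma total_recursive_vec_Cons:
  assumes "total_recursive m f" "total_recursive_vec m k A"
  shows "total_recursive_vec m (Suc k) (\<lambda>xs. f xs # A xs)"
proof -
  obtain c cs where "\<And>xs. length xs = m \<Longrightarrow> eval c xs = Some (f xs)"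
    "\<And>xs. length xs = m \<Longrightarrow> length (A xs) = k \<and> those (map (\<lambda>c. eval c xs) cs) = Some (A xs)"
    using assms unfolding total_recursive_def total_recursive_vec_def by blast
  then show ?thesis
    unfolding total_recursive_vec_def by (intro exI[of _ "c # cs"]) simp
qed

lemma total_recursive_vec_map:
  assumes "\<And>g. g \<in> set gs \<Longrightarrow> total_recursive m (h g)"
  shows "total_recursive_vec m (length gs) (\<lambda>xs. map (\<lambda>g. h g xs) gs)"
  using assms
  by (induction gs) (auto intro: total_recursive_vec_Nil total_recursive_vec_Cons)

lemma total_recursive_nth: "i < m \<Longrightarrow> total_recursive m (\<lambda>xs. xs ! i)"
  unfolding total_recursive_def by (rule exI[of _ "Proj i"]) simp

lemma total_recursive_vec_drop: "total_recursive_vec m (m - d) (drop d)"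
proof -
  have "those (map (\<lambda>c. eval c xs) (map Proj [d..<m])) = Some (drop d xs)"
    if "length xs = m" for xs
    using that by (auto simp: those_eq_Some_iff intro!: nth_equalityI)
  then show ?thesis
    unfolding total_recursive_vec_def by (intro exI[of _ "map Proj [d..<m]"]) simp
qed

lemma total_recursive_vec_id: "total_recursive_vec m m (\<lambda>xs. xs)"
  using total_recursive_vec_drop[of m 0] by simp

lemma total_recursive_comp:
  assumes "total_recursive k f" "total_recursive_vec m k A"
  shows "total_recursive m (\<lambda>xs. f (A xs))"
proof -
  obtain c cs where "\<And>ys. length ys = k \<Longrightarrow> eval c ys = Some (f ys)"
    "\<And>xs. length xs = m \<Longrightarrow> length (A xs) = k \<and> those (map (\<lambda>c. eval c xs) cs) = Some (A xs)"
    using assms unfolding total_recursive_def total_recursive_vec_def by blast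
  then show ?thesis
    unfolding total_recursive_def by (intro exI[of _ "Comp c cs"]) simp
qed

lemma total_recursive_comp1:
  assumes "total_recursive 1 (\<lambda>ys. f (ys ! 0))" "total_recursive m a"
  shows "total_recursive m (\<lambda>xs. f (a xs))"
  using total_recursive_comp[OF assms(1)[unfolded One_nat_def]
      total_recursive_vec_Cons[OF assms(2) total_recursive_vec_Nil]] by simp

lemma total_recursive_comp2:
  assumes "total_recursive 2 (\<lambda>ys. f (ys ! 0) (ys ! 1))"
    "total_recursive m a" "total_recursive m b"
  shows "total_recursive m (\<lambda>xs. f (a xs) (b xs))"
  using total_recursive_comp[OF assms(1)[unfolded numeral_2_eq_2]
      total_recursive_vec_Cons[OF assms(2)
        total_recursive_vec_Cons[OF assms(3) total_recursive_vec_Nil]]] by simp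

lemma total_recursive_Suc:
  assumes "total_recursive m a"
  shows "total_recursive m (\<lambda>xs. Suc (a xs))"
proof (rule total_recursive_comp1[OF _ assms])
  show "total_recursive 1 (\<lambda>ys. Suc (ys ! 0))"
    unfolding total_recursive_def
    by (rule exI[of _ Succ]) (auto simp: length_Suc_conv)
qed

lemma total_recursive_const: "total_recursive m (\<lambda>_. n)"
proof (induction n)
  case 0
  show ?case
    unfolding total_recursive_def by (rule exI[of _ Zero]) simp
qed (rule total_recursive_Suc)

lemma total_recursive_rec_nat:
  assumes b: "total_recursive m b" and f: "total_recursive m f"
    and g: "total_recursive (Suc (Suc m)) (\<lambda>ys. g (ys ! 0) (ys ! 1) (drop 2 ys))"
  shows "total_recursive m (\<lambda>xs. rec_nat (f xs) (\<lambda>k r. g k r xs) (b xs))"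
proof -
  obtain cf where cf: "\<And>xs. length xs = m \<Longrightarrow> eval cf xs = Some (f xs)"
    using f unfolding total_recursive_def by blast
  obtain cg where cg: "\<And>ys. length ys = Suc (Suc m) \<Longrightarrow>
      eval cg ys = Some (g (ys ! 0) (ys ! 1) (drop 2 ys))"
    using g unfolding total_recursive_def by blast
  have "rec_nat (eval cf xs) (\<lambda>k r. Option.bind r (\<lambda>v. eval cg (k # v # xs))) n =
      Some (rec_nat (f xs) (\<lambda>k r. g k r xs) n)" if "length xs = m" for xs n
    using that by (induction n) (simp_all add: cf cg)
  then have "total_recursive (Suc m)
      (\<lambda>ys. rec_nat (f (tl ys)) (\<lambda>k r. g k r (tl ys)) (hd ys))"
    unfolding total_recursive_def
    by (intro exI[of _ "Prec cf cg"]) (auto simp: length_Suc_conv)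
  from total_recursive_comp[OF this
      total_recursive_vec_Cons[OF b total_recursive_vec_id]]
  show ?thesis by simp
qed

lemma total_recursive_add:
  assumes "total_recursive m a" "total_recursive m b"
  shows "total_recursive m (\<lambda>xs. a xs + b xs)"
proof (rule total_recursive_comp2[OF _ assms])
  have "total_recursive 2 (\<lambda>ys. rec_nat (ys ! 1) (\<lambda>k r. Suc r) (ys ! 0))"
    by (intro total_recursive_rec_nat total_recursive_Suc total_recursive_nth) auto
  moreover have "rec_nat y (\<lambda>k r. Suc r) x = x + y" for x y :: nat
    by (induction x) auto
  ultimately show "total_recursive 2 (\<lambda>ys. ys ! 0 + ys ! 1)"
    by simp
qed

lemma total_recursive_pred:
  assumes "total_recursive m a"
  shows "total_recursive m (\<lambda>xs. a xs - 1)"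
proof (rule total_recursive_comp1[OF _ assms])
  have "total_recursive 1 (\<lambda>ys. rec_nat 0 (\<lambda>k r. k) (ys ! 0))"
    by (intro total_recursive_rec_nat total_recursive_const total_recursive_nth) auto
  moreover have "rec_nat 0 (\<lambda>k r. k) x = x - 1" for x :: nat
    by (cases x) auto
  ultimately show "total_recursive 1 (\<lambda>ys. ys ! 0 - 1)"
    by simp
qed

lemma total_recursive_diff:
  assumes "total_recursive m a" "total_recursive m b"
  shows "total_recursive m (\<lambda>xs. a xs - b xs)"
proof (rule total_recursive_comp2[OF _ assms])
  have "total_recursive 2 (\<lambda>ys. rec_nat (ys ! 0) (\<lambda>k r. r - 1) (ys ! 1))"
    by (intro total_recursive_rec_nat total_recursive_pred total_recursive_nth) auto
  moreover have "rec_nat x (\<lambda>k r. r - 1) y = x - y" for x y :: nat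
    by (induction y) auto
  ultimately show "total_recursive 2 (\<lambda>ys. ys ! 0 - ys ! 1)"
    by simp
qed

lemma total_recursive_if_zero:
  assumes a: "total_recursive m a" and b: "total_recursive m b" and c: "total_recursive m c"
  shows "total_recursive m (\<lambda>xs. if a xs = 0 then b xs else c xs)"
proof -
  have "total_recursive (Suc (Suc m)) (\<lambda>ys. c (drop 2 ys))"
    using total_recursive_comp[OF c] total_recursive_vec_drop[of "Suc (Suc m)" 2] by simp
  then have "total_recursive m (\<lambda>xs. rec_nat (b xs) (\<lambda>k r. c xs) (a xs))"
    by (intro total_recursive_rec_nat a b)
  moreover have "rec_nat y (\<lambda>k r. z) x = (if x = 0 then y else z)" for x y z :: nat
    by (cases x) auto
  ultimately show ?thesis by simp
qed

lemma total_recursive_sum: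
  assumes b: "total_recursive m b"
    and g: "total_recursive (Suc m) (\<lambda>ys. g (ys ! 0) (drop 1 ys))"
  shows "total_recursive m (\<lambda>xs. \<Sum>j<b xs. g j xs)"
proof -
  have "total_recursive (Suc (Suc m)) (\<lambda>ys. g (ys ! 0) (drop 2 ys))"
    using total_recursive_comp[OF g total_recursive_vec_Cons[OF
          total_recursive_nth[of 0] total_recursive_vec_drop[of "Suc (Suc m)" 2, simplified]]]
    by simp
  then have "total_recursive m (\<lambda>xs. rec_nat 0 (\<lambda>k r. r + g k xs) (b xs))"
    by (intro total_recursive_rec_nat total_recursive_add total_recursive_const
        total_recursive_nth b) auto
  moreover have "rec_nat 0 (\<lambda>k r. r + g k xs) n = (\<Sum>j<n. g j xs)" for xs n
    by (induction n) auto
  ultimately show ?thesis by simp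
qed

lemma total_recursive_prod_encode:
  assumes "total_recursive m a" "total_recursive m b"
  shows "total_recursive m (\<lambda>xs. prod_encode (a xs, b xs))"
proof -
  have triangle: "triangle n = (\<Sum>j<n. Suc j)" for n
    by (induction n) auto
  have "total_recursive 1 (\<lambda>ys. \<Sum>j<ys ! 0. Suc j)"
    by (intro total_recursive_sum total_recursive_Suc total_recursive_nth) auto
  then have "total_recursive 1 (\<lambda>ys. triangle (ys ! 0))"
    by (simp only: triangle)
  note total_recursive_triangle = total_recursive_comp1[OF this]
  show ?thesis
    unfolding prod_encode_def prod.case
    by (intro total_recursive_add total_recursive_triangle assms)
qed

subsection \<open>Approximation of partial recursive functions by total ones\<close>

text \<open>\<open>h (s # xs)\<close> is the outcome of the computation at stage \<open>s\<close>: \<open>0\<close> if it has not yet been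
  seen to halt, \<open>Suc v\<close> if it has halted with value \<open>v\<close>.\<close>

definition approximates :: "nat \<Rightarrow> (nat list \<Rightarrow> nat) \<Rightarrow> (nat list \<Rightarrow> nat option) \<Rightarrow> bool" where
  "approximates m h F \<longleftrightarrow>
     (\<forall>xs. length xs = m \<longrightarrow>
        (\<forall>s v. h (s # xs) = Suc v \<longrightarrow> F xs = Some v) \<and>
        (\<forall>v. F xs = Some v \<longrightarrow> (\<forall>\<^sub>F s in sequentially. h (s # xs) = Suc v)))"

lemma approximatesI:
  assumes "\<And>xs s v. length xs = m \<Longrightarrow> h (s # xs) = Suc v \<Longrightarrow> F xs = Some v"
    and "\<And>xs v. length xs = m \<Longrightarrow> F xs = Some v \<Longrightarrow> \<forall>\<^sub>F s in sequentially. h (s # xs) = Suc v"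
  shows "approximates m h F"
  using assms unfolding approximates_def by blast

lemma approximates_sound:
  "approximates m h F \<Longrightarrow> length xs = m \<Longrightarrow> h (s # xs) = Suc v \<Longrightarrow> F xs = Some v"
  unfolding approximates_def by blast

lemma approximates_complete:
  "approximates m h F \<Longrightarrow> length xs = m \<Longrightarrow> F xs = Some v \<Longrightarrow>
     \<forall>\<^sub>F s in sequentially. h (s # xs) = Suc v"
  unfolding approximates_def by blast

lemma approximates_Comp:
  assumes f: "approximates (length gs) hf (eval f)"
    and g: "\<And>g. g \<in> set gs \<Longrightarrow> approximates m (hg g) (eval g)"
  shows "approximates m
    (\<lambda>ys. if (\<Sum>i<length gs. 1 - hg (gs ! i) ys) = 0
          then hf (ys ! 0 # map (\<lambda>g. hg g ys - 1) gs) else 0) (eval (Comp f gs))"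
proof (rule approximatesI, goal_cases)
  case (1 xs s v)
  have nz: "hg g (s # xs) \<noteq> 0" if "g \<in> set gs" for g
    using 1(2) that by (force simp: in_set_conv_nth split: if_splits)
  have hf: "hf (s # map (\<lambda>g. hg g (s # xs) - 1) gs) = Suc v"
    using 1(2) by (auto split: if_splits)
  have "eval g xs = Some (hg g (s # xs) - 1)" if "g \<in> set gs" for g
    using approximates_sound[OF g[OF that] 1(1), of s "hg g (s # xs) - 1"] nz[OF that] by simp
  then have "those (map (\<lambda>g. eval g xs) gs) = Some (map (\<lambda>g. hg g (s # xs) - 1) gs)"
    by (simp add: those_eq_Some_iff)
  with approximates_sound[OF f _ hf] show ?case by simp
next
  case (2 xs v)
  then obtain zs where zs: "those (map (\<lambda>g. eval g xs) gs) = Some zs" "eval f zs = Some v"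
    by (auto simp: bind_eq_Some_conv)
  from zs(1) have map: "map (\<lambda>g. eval g xs) gs = map Some zs"
    by (simp add: those_eq_Some_iff)
  then have len: "length zs = length gs"
    by (metis length_map)
  have "\<forall>\<^sub>F s in sequentially. \<forall>i\<in>{..<length gs}. hg (gs ! i) (s # xs) = Suc (zs ! i)"
  proof (intro eventually_ball_finite ballI finite_lessThan)
    fix i assume i: "i \<in> {..<length gs}"
    then have "eval (gs ! i) xs = Some (zs ! i)"
      using arg_cong[OF map, of "\<lambda>l. l ! i"] len by simp
    then show "\<forall>\<^sub>F s in sequentially. hg (gs ! i) (s # xs) = Suc (zs ! i)"
      using i by (intro approximates_complete[OF g 2(1)]) auto
  qed
  moreover have "\<forall>\<^sub>F s in sequentially. hf (s # zs) = Suc v"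
    by (rule approximates_complete[OF f len zs(2)])
  ultimately show ?case
  proof eventually_elim
    case (elim s)
    have "map (\<lambda>g. hg g (s # xs) - 1) gs = zs"
      using elim(1) len by (intro nth_equalityI) auto
    with elim show ?case by simp
  qed
qed

lemma approximates_Prec:
  assumes f: "approximates m hf (eval f)" and g: "approximates (Suc (Suc m)) hg (eval g)"
  shows "approximates (Suc m)
    (\<lambda>ys. rec_nat (hf (ys ! 0 # drop 2 ys))
       (\<lambda>k r. if r = 0 then 0 else hg (ys ! 0 # k # (r - 1) # drop 2 ys)) (ys ! 1))
    (eval (Prec f g))"
proof (rule approximatesI, goal_cases)
  case (1 xs s v)
  then obtain n ys where xs: "xs = n # ys" and len: "length ys = m"
    by (auto simp: length_Suc_conv)
  have "rec_nat (eval f ys) (\<lambda>k r. Option.bind r (\<lambda>v. eval g (k # v # ys))) n = Some v"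
    if "rec_nat (hf (s # ys)) (\<lambda>k r. if r = 0 then 0 else hg (s # k # (r - 1) # ys)) n = Suc v"
    for n v
    using that
  proof (induction n arbitrary: v)
    case 0
    then show ?case using approximates_sound[OF f len] by simp
  next
    case (Suc n)
    define r where
      "r = rec_nat (hf (s # ys)) (\<lambda>k r. if r = 0 then 0 else hg (s # k # (r - 1) # ys)) n"
    have r: "r \<noteq> 0" "hg (s # n # (r - 1) # ys) = Suc v"
      using Suc.prems by (auto simp: r_def split: if_splits)
    then have "eval g (n # (r - 1) # ys) = Some v"
      by (intro approximates_sound[OF g]) (simp_all add: len)
    with Suc.IH[of "r - 1"] r(1) show ?case
      by (simp add: r_def)
  qed
  with 1 show ?case by (simp add: xs cong: if_cong)
next
  case (2 xs v)
  then obtain n ys where xs: "xs = n # ys" and len: "length ys = m"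
    by (auto simp: length_Suc_conv)
  have "\<forall>\<^sub>F s in sequentially.
      rec_nat (hf (s # ys)) (\<lambda>k r. if r = 0 then 0 else hg (s # k # (r - 1) # ys)) n = Suc v"
    if "rec_nat (eval f ys) (\<lambda>k r. Option.bind r (\<lambda>v. eval g (k # v # ys))) n = Some v"
    for n v
    using that
  proof (induction n arbitrary: v)
    case 0
    then show ?case using approximates_complete[OF f len] by simp
  next
    case (Suc n)
    then obtain u where
      u: "rec_nat (eval f ys) (\<lambda>k r. Option.bind r (\<lambda>v. eval g (k # v # ys))) n = Some u"
        "eval g (n # u # ys) = Some v"
      by (auto simp: bind_eq_Some_conv)
    have "\<forall>\<^sub>F s in sequentially. hg (s # n # u # ys) = Suc v"
      by (rule approximates_complete[OF g _ u(2)]) (simp add: len)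
    with Suc.IH[OF u(1)] show ?case
      by eventually_elim simp
  qed
  with 2 show ?case by (simp add: xs cong: if_cong)
qed

text \<open>A bounded search for the least \<open>k\<close> with \<open>a k = 1\<close>: state \<open>0\<close> means that the search goes on,
  \<open>1\<close> that it met an undefined value, and \<open>n + 2\<close> that it found \<open>n\<close>.\<close>

definition search :: "(nat \<Rightarrow> nat) \<Rightarrow> nat \<Rightarrow> nat" where
  "search a = rec_nat 0 (\<lambda>k r. if r = 0
     then (if a k = 0 then 1 else if a k - 1 = 0 then k + 2 else 0) else r)"

lemma search_eq_0_iff: "search a b = 0 \<longleftrightarrow> (\<forall>j<b. a j > 1)"
  by (induction b) (auto simp: search_def less_Suc_eq)

lemma search_found_iff:
  "search a b = n + 2 \<longleftrightarrow> n < b \<and> a n = 1 \<and> (\<forall>j<n. a j > 1)"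
proof (induction b)
  case 0
  then show ?case by (simp add: search_def)
next
  case (Suc b)
  have step: "search a (Suc b) = (if search a b = 0
     then (if a b = 0 then 1 else if a b - 1 = 0 then b + 2 else 0) else search a b)"
    by (simp add: search_def)
  show ?case
  proof (cases "search a b = 0")
    case True
    then have *: "\<forall>j<b. a j > 1"
      by (simp add: search_eq_0_iff)
    then have "\<not> (n < b \<and> a n = 1)"
      by auto
    with True * show ?thesis
      by (auto simp: step less_Suc_eq)
  next
    case False
    then have "\<not> (\<forall>j<b. a j > 1)"
      by (simp add: search_eq_0_iff)
    with False Suc show ?thesis
      by (auto simp: step less_Suc_eq)
  qed
qed

lemma eval_Mu_eq_Some_iff:
  "eval (Mu f) xs = Some n \<longleftrightarrow>
     eval f (n # xs) = Some 0 \<and> (\<forall>k<n. \<exists>v. eval f (k # xs) = Some (Suc v))" (is "_ \<longleftrightarrow> ?R n")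
proof
  assume "eval (Mu f) xs = Some n"
  then obtain m where m: "eval f (m # xs) = Some 0" "\<forall>k<m. eval f (k # xs) \<noteq> None"
    and n: "n = (LEAST n. eval f (n # xs) = Some 0)"
    by (auto split: if_splits)
  have "eval f (n # xs) = Some 0"
    unfolding n by (rule LeastI[of _ m]) (rule m(1))
  moreover have "n \<le> m"
    unfolding n by (rule Least_le) (rule m(1))
  moreover have "eval f (k # xs) \<noteq> Some 0" if "k < n" for k
    using that unfolding n by (rule not_less_Least)
  ultimately show "?R n"
    using m(2) by (metis less_le_trans not0_implies_Suc option.exhaust)
next
  assume R: "?R n"
  then have "(LEAST n. eval f (n # xs) = Some 0) = n"
    by (intro Least_equality) (auto simp flip: not_less)
  with R show "eval (Mu f) xs = Some n"
    by force
qed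

lemma approximates_Mu:
  assumes f: "approximates (Suc m) hf (eval f)"
  shows "approximates m
    (\<lambda>ys. search (\<lambda>k. hf (ys ! 0 # k # drop 1 ys)) (ys ! 0) - 1) (eval (Mu f))"
proof (rule approximatesI, goal_cases)
  case (1 xs s v)
  then have "search (\<lambda>k. hf (s # k # xs)) s = v + 2"
    by simp
  then have *: "hf (s # v # xs) = 1" "\<forall>j<v. hf (s # j # xs) > 1"
    by (auto simp only: search_found_iff)
  have "eval f (v # xs) = Some 0"
    by (rule approximates_sound[OF f, of _ s]) (simp_all add: 1(1) *(1))
  moreover have "\<exists>w. eval f (k # xs) = Some (Suc w)" if "k < v" for k
  proof -
    obtain w where w: "hf (s # k # xs) = Suc (Suc w)"
      using *(2) \<open>k < v\<close> by (auto dest!: spec[of _ k] less_imp_Suc_add)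
    show ?thesis
      using approximates_sound[OF f _ w] 1(1) by auto
  qed
  ultimately show ?case by (simp only: eval_Mu_eq_Some_iff) blast
next
  case (2 xs v)
  then have *: "eval f (v # xs) = Some 0" "\<forall>k<v. \<exists>w. eval f (k # xs) = Some (Suc w)"
    unfolding eval_Mu_eq_Some_iff by blast+
  have "\<forall>\<^sub>F s in sequentially. hf (s # v # xs) = Suc 0"
    by (rule approximates_complete[OF f _ *(1)]) (simp add: 2(1))
  moreover have "\<forall>\<^sub>F s in sequentially. \<forall>k\<in>{..<v}. hf (s # k # xs) > 1"
  proof (intro eventually_ball_finite ballI finite_lessThan)
    fix k assume "k \<in> {..<v}"
    then obtain w where w: "eval f (k # xs) = Some (Suc w)"
      using *(2) by auto
    have "\<forall>\<^sub>F s in sequentially. hf (s # k # xs) = Suc (Suc w)"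
      by (rule approximates_complete[OF f _ w]) (simp add: 2(1))
    then show "\<forall>\<^sub>F s in sequentially. hf (s # k # xs) > 1"
      by eventually_elim simp
  qed
  moreover have "\<forall>\<^sub>F s in sequentially. v < s"
    by (rule eventually_gt_at_top)
  ultimately show ?case
  proof eventually_elim
    case (elim s)
    then have "search (\<lambda>k. hf (s # k # xs)) s = v + 2"
      by (subst search_found_iff) simp
    then show ?case by simp
  qed
qed

lemma approximable:
  "\<exists>h. total_recursive (Suc m) h \<and> approximates m h (eval c)"
proof (induction c arbitrary: m)
  case Zero
  have "approximates m (\<lambda>_. Suc 0) (eval Zero)"
    by (rule approximatesI) auto
  then show ?case using total_recursive_const by blast
next
  case Succ
  show ?case
  proof (cases m)
    case 0
    then have "approximates m (\<lambda>_. 0) (eval Succ)"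
      by (intro approximatesI) auto
    then show ?thesis using total_recursive_const by blast
  next
    case (Suc k)
    then have "approximates m (\<lambda>ys. Suc (Suc (ys ! 1))) (eval Succ)"
      by (intro approximatesI) (auto simp: length_Suc_conv)
    moreover have "total_recursive (Suc m) (\<lambda>ys. Suc (Suc (ys ! 1)))"
      using Suc by (intro total_recursive_Suc total_recursive_nth) auto
    ultimately show ?thesis by blast
  qed
next
  case (Proj i)
  show ?case
  proof (cases "i < m")
    case False
    then have "approximates m (\<lambda>_. 0) (eval (Proj i))"
      by (intro approximatesI) auto
    then show ?thesis using total_recursive_const by blast
  next
    case True
    then have "approximates m (\<lambda>ys. Suc (ys ! Suc i)) (eval (Proj i))"
      by (intro approximatesI) auto
    moreover have "total_recursive (Suc m) (\<lambda>ys. Suc (ys ! Suc i))"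
      using True by (intro total_recursive_Suc total_recursive_nth) auto
    ultimately show ?thesis by blast
  qed
next
  case (Comp f gs)
  obtain hf where hf: "total_recursive (Suc (length gs)) hf" "approximates (length gs) hf (eval f)"
    using Comp.IH(1) by blast
  obtain hg where hg: "\<And>g. g \<in> set gs \<Longrightarrow> total_recursive (Suc m) (hg g)"
    "\<And>g. g \<in> set gs \<Longrightarrow> approximates m (hg g) (eval g)"
  proof -
    have "\<forall>g\<in>set gs. \<exists>h. total_recursive (Suc m) h \<and> approximates m h (eval g)"
      using Comp.IH(2) by blast
    then show ?thesis
      using that by (auto dest!: bchoice)
  qed
  have sum: "total_recursive (Suc m) (\<lambda>ys. \<Sum>i<k. 1 - hg (gs ! i) ys)" if "k \<le> length gs" for k
    using that
    by (induction k)
      (auto intro!: total_recursive_add total_recursive_diff total_recursive_const hg(1))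
  have "total_recursive (Suc m)
    (\<lambda>ys. if (\<Sum>i<length gs. 1 - hg (gs ! i) ys) = 0
          then hf (ys ! 0 # map (\<lambda>g. hg g ys - 1) gs) else 0)"
    by (intro total_recursive_if_zero total_recursive_const sum order_refl
        total_recursive_comp[OF hf(1)] total_recursive_vec_Cons total_recursive_vec_map
        total_recursive_pred hg(1) total_recursive_nth) auto
  with approximates_Comp[OF hf(2) hg(2)] show ?case by blast
next
  case (Prec f g)
  show ?case
  proof (cases m)
    case 0
    then have "approximates m (\<lambda>_. 0) (eval (Prec f g))"
      by (intro approximatesI) auto
    then show ?thesis using total_recursive_const by blast
  next
    case (Suc k)
    obtain hf hg where hf: "total_recursive (Suc k) hf" "approximates k hf (eval f)"
      and hg: "total_recursive (Suc (Suc (Suc k))) hg" "approximates (Suc (Suc k)) hg (eval g)"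
      using Prec.IH by meson
    have vec: "total_recursive_vec (Suc (Suc k)) k (\<lambda>ys. drop 2 ys)"
      "total_recursive_vec (Suc (Suc (Suc (Suc k)))) k (\<lambda>ys. drop 2 (drop 2 ys))"
      using total_recursive_vec_drop[of "Suc (Suc k)" 2]
        total_recursive_vec_drop[of "Suc (Suc (Suc (Suc k)))" 4] by simp_all
    have "total_recursive (Suc (Suc (Suc (Suc k)))) (\<lambda>ys. drop 2 ys ! 0)"
      by (rule total_recursive_cong[OF total_recursive_nth[of 2]]) auto
    then have "total_recursive (Suc (Suc k))
      (\<lambda>ys. rec_nat (hf (ys ! 0 # drop 2 ys))
         (\<lambda>k r. if r = 0 then 0 else hg (ys ! 0 # k # (r - 1) # drop 2 ys)) (ys ! 1))"
      by (intro total_recursive_rec_nat total_recursive_if_zero total_recursive_const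
          total_recursive_comp[OF hf(1)] total_recursive_comp[OF hg(1)]
          total_recursive_vec_Cons total_recursive_pred vec total_recursive_nth) auto
    with approximates_Prec[OF hf(2) hg(2)] Suc show ?thesis by blast
  qed
next
  case (Mu f)
  obtain hf where hf: "total_recursive (Suc (Suc m)) hf" "approximates (Suc m) hf (eval f)"
    using Mu.IH by blast
  have vec: "total_recursive_vec (Suc (Suc (Suc m))) m (\<lambda>ys. drop 1 (drop 2 ys))"
    using total_recursive_vec_drop[of "Suc (Suc (Suc m))" 3] by (simp add: numeral_3_eq_3)
  have "total_recursive (Suc (Suc (Suc m))) (\<lambda>ys. drop 2 ys ! 0)"
    by (rule total_recursive_cong[OF total_recursive_nth[of 2]]) auto
  then have a: "total_recursive (Suc (Suc (Suc m)))
      (\<lambda>ys. hf (drop 2 ys ! 0 # ys ! 0 # drop 1 (drop 2 ys)))"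
    by (intro total_recursive_comp[OF hf(1)] total_recursive_vec_Cons vec total_recursive_nth) auto
  have "total_recursive (Suc m)
      (\<lambda>ys. search (\<lambda>k. hf (ys ! 0 # k # drop 1 ys)) (ys ! 0) - 1)"
    unfolding search_def
    by (intro total_recursive_pred total_recursive_rec_nat total_recursive_if_zero
        total_recursive_add total_recursive_const a total_recursive_nth) auto
  with approximates_Mu[OF hf(2)] show ?case by blast
qed

subsection \<open>Indices of uniformly c.e. families\<close>

primrec const_recf :: "nat \<Rightarrow> recf" where
  "const_recf 0 = Zero"
| "const_recf (Suc n) = Comp Succ [const_recf n]"

lemma eval_const_recf [simp]: "eval (const_recf n) xs = Some n"
  by (induction n) auto

lemma computable_uniform_index:
  "\<exists>f. computable f \<and> (\<forall>n. W (f n) = {x. eval c [n, x] \<noteq> None})"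
proof -
  define f where "f n = encode (Comp c [const_recf n, Proj 0])" for n
  have const: "encode (const_recf n) = rec_nat (prod_encode (0, 0))
      (\<lambda>k r. prod_encode (3, prod_encode (encode Succ, Suc (prod_encode (r, 0))))) n" for n
    by (induction n) auto
  have "total_recursive 1 (\<lambda>xs. f (xs ! 0))"
    unfolding f_def encode.simps(4) list.map list_encode.simps const
    by (intro total_recursive_prod_encode total_recursive_Suc total_recursive_const
        total_recursive_rec_nat total_recursive_nth) auto
  then obtain d where "\<And>xs. length xs = 1 \<Longrightarrow> eval d xs = Some (f (xs ! 0))"
    unfolding total_recursive_def by blast
  then have "eval d [n] = Some (f n)" for n
    by simp
  then have "computable f"
    unfolding computable_def by blast
  moreover have "W (f n) = {x. eval c [n, x] \<noteq> None}" for n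
  proof -
    have "W (f n) = {x. eval (Comp c [const_recf n, Proj 0]) [x] \<noteq> None}"
      unfolding W_def f_def by (blast dest: encode_inject)
    then show ?thesis by simp
  qed
  ultimately show ?thesis by blast
qed

lemma eval_Mu_total:
  assumes "\<And>k. eval c (k # xs) = Some (h k)"
  shows "eval (Mu c) xs = (if \<exists>k. h k = 0 then Some (LEAST k. h k = 0) else None)"
  using assms by simp

subsection \<open>The array of initial segments of columns\<close>

definition column_reps :: "(nat \<times> nat) set \<Rightarrow> nat \<Rightarrow> nat set" where
  "column_reps R n = {j. \<forall>i<j. (prod_encode (n, i), prod_encode (n, j)) \<notin> R}"

definition column_segment :: "(nat \<times> nat) set \<Rightarrow> nat \<Rightarrow> nat set" where
  "column_segment R n = {prod_encode (n, k) |k. card (column_reps R n \<inter> {..<k}) \<le> n}"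

lemma column_segment_ce:
  assumes "ce_rel R"
  shows "\<exists>c. \<forall>n. column_segment R n = {x. eval c [n, x] \<noteq> None}"
proof -
  obtain d where d: "R = {(x, y). eval d [x, y] \<noteq> None}"
    using assms unfolding ce_rel_def by blast
  obtain h where h: "total_recursive (Suc 2) h" "approximates 2 h (eval d)"
    using approximable by blast
  have sound: "(x, y) \<in> R" if "h [s, x, y] \<noteq> 0" for s x y
    using approximates_sound[OF h(2), of "[x, y]" s "h [s, x, y] - 1"] that by (simp add: d)
  have complete: "\<forall>\<^sub>F s in sequentially. h [s, x, y] \<noteq> 0" if xy: "(x, y) \<in> R" for x y
  proof -
    obtain v where "eval d [x, y] = Some v"
      using xy by (auto simp: d)
    then have "\<forall>\<^sub>F s in sequentially. h [s, x, y] = Suc v"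
      by (intro approximates_complete[OF h(2)]) auto
    then show ?thesis
      by eventually_elim simp
  qed
  define new where
    "new s n j = 1 - (\<Sum>i<j. h [s, prod_encode (n, i), prod_encode (n, j)])" for s n j
  define count where "count s n k = (\<Sum>j<k. new s n j)" for s n k
  have reps: "card (column_reps R n \<inter> {..<k}) = (\<Sum>j<k. of_bool (j \<in> column_reps R n))" for n k
    by (simp add: Int_commute)
  have new_ge: "of_bool (j \<in> column_reps R n) \<le> new s n j" for s n j
  proof (cases "j \<in> column_reps R n")
    case True
    then have "h [s, prod_encode (n, i), prod_encode (n, j)] = 0" if "i < j" for i
      using sound that by (force simp: column_reps_def)
    then show ?thesis by (simp add: new_def)
  qed simp
  have new_le: "\<forall>\<^sub>F s in sequentially. new s n j \<le> of_bool (j \<in> column_reps R n)" for n j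
  proof (cases "j \<in> column_reps R n")
    case True
    then show ?thesis by (simp add: new_def)
  next
    case False
    then obtain i where i: "i < j" "(prod_encode (n, i), prod_encode (n, j)) \<in> R"
      by (auto simp: column_reps_def)
    from complete[OF i(2)] show ?thesis
    proof eventually_elim
      case (elim s)
      then have "(\<Sum>i<j. h [s, prod_encode (n, i), prod_encode (n, j)]) \<noteq> 0"
        using i(1) by auto
      then have "new s n j = 0"
        unfolding new_def by linarith
      then show ?case by simp
    qed
  qed
  have count: "card (column_reps R n \<inter> {..<k}) \<le> n \<longleftrightarrow> (\<exists>s. count s n k - n = 0)" for n k
  proof
    have "\<forall>\<^sub>F s in sequentially. \<forall>j\<in>{..<k}. new s n j \<le> of_bool (j \<in> column_reps R n)"
      by (intro eventually_ball_finite ballI finite_lessThan new_le)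
    then obtain s where "\<forall>j\<in>{..<k}. new s n j \<le> of_bool (j \<in> column_reps R n)"
      by (auto simp: eventually_sequentially)
    then have "count s n k \<le> card (column_reps R n \<inter> {..<k})"
      unfolding count_def reps by (intro sum_mono) auto
    moreover assume "card (column_reps R n \<inter> {..<k}) \<le> n"
    ultimately show "\<exists>s. count s n k - n = 0"
      by (intro exI[of _ s]) simp
  next
    assume "\<exists>s. count s n k - n = 0"
    then obtain s where "count s n k \<le> n" by auto
    moreover have "card (column_reps R n \<inter> {..<k}) \<le> count s n k"
      unfolding count_def reps by (intro sum_mono new_ge)
    ultimately show "card (column_reps R n \<inter> {..<k}) \<le> n" by simp
  qed
  have "total_recursive 3 (\<lambda>xs. count (xs ! 0) (xs ! 1) (xs ! 2) - xs ! 1)"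
  proof -
    have drop1: "total_recursive 4 (\<lambda>ys. drop 1 ys ! i)" if "i < 3" for i
      by (rule total_recursive_cong[OF total_recursive_nth[of "Suc i"]]) (use that in auto)
    have drop2: "total_recursive 5 (\<lambda>ys. drop 1 (drop 1 ys) ! i)"
      "total_recursive 5 (\<lambda>ys. drop 1 ys ! i)" if "i < 3" for i
      by (rule total_recursive_cong[OF total_recursive_nth[of "Suc (Suc i)"]]
          total_recursive_cong[OF total_recursive_nth[of "Suc i"]]; use that in auto)+
    have num: "Suc 3 = 4" "Suc 4 = 5" "Suc (Suc (Suc 0)) = Suc 2"
      by simp_all
    show ?thesis
      unfolding count_def new_def
      by (intro total_recursive_diff total_recursive_sum total_recursive_const
          total_recursive_comp[OF h(1)[folded num(3)]] total_recursive_vec_Cons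
          total_recursive_vec_Nil total_recursive_prod_encode; (unfold num)?;
          (rule total_recursive_nth drop1 drop2; simp)?)
  qed
  then obtain p where
    "\<And>xs. length xs = 3 \<Longrightarrow> eval p xs = Some (count (xs ! 0) (xs ! 1) (xs ! 2) - xs ! 1)"
    unfolding total_recursive_def by blast
  then have "eval p (s # [n, k]) = Some (count s n k - n)" for s n k
    by simp
  from eval_Mu_total[OF this]
  have p: "eval (Mu p) [n, k] \<noteq> None \<longleftrightarrow> card (column_reps R n \<inter> {..<k}) \<le> n" for n k
    unfolding count by simp
  have "total_recursive 3 (\<lambda>xs. (prod_encode (xs ! 1, xs ! 0) - xs ! 2) +
      (xs ! 2 - prod_encode (xs ! 1, xs ! 0)))"
    by (intro total_recursive_add total_recursive_diff total_recursive_prod_encode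
        total_recursive_nth) auto
  then obtain q where
    "\<And>xs. length xs = 3 \<Longrightarrow> eval q xs = Some ((prod_encode (xs ! 1, xs ! 0) - xs ! 2) +
      (xs ! 2 - prod_encode (xs ! 1, xs ! 0)))"
    unfolding total_recursive_def by blast
  then have "eval q (k # [n, x]) =
      Some ((prod_encode (n, k) - x) + (x - prod_encode (n, k)))" for k n x
    by simp
  moreover have "(a - x) + (x - a) = 0 \<longleftrightarrow> a = x" for a x :: nat
    by arith
  ultimately have q: "eval (Mu q) [n, x] = (if \<exists>k. prod_encode (n, k) = x
      then Some (LEAST k. prod_encode (n, k) = x) else None)" for n x
    by (simp only: eval_Mu_total)
  have "eval (Comp (Mu p) [Proj 0, Mu q]) [n, x] \<noteq> None \<longleftrightarrow> x \<in> column_segment R n" for n x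
  proof (cases "\<exists>k. prod_encode (n, k) = x")
    case True
    then obtain k where k: "prod_encode (n, k) = x" by blast
    then have "(LEAST k. prod_encode (n, k) = x) = k"
      by (intro Least_equality) auto
    with k q[of n x] have "eval (Mu q) [n, x] = Some k"
      by auto
    then have "eval (Comp (Mu p) [Proj 0, Mu q]) [n, x] = eval (Mu p) [n, k]"
      by (simp del: eval.simps(6))
    with p[of n k] k show ?thesis
      by (auto simp: column_segment_def simp del: eval.simps)
  next
    case False
    then have "eval (Mu q) [n, x] = None"
      by (simp only: q) simp
    then have "eval (Comp (Mu p) [Proj 0, Mu q]) [n, x] = None"
      by (simp del: eval.simps(6))
    with False show ?thesis
      by (auto simp: column_segment_def simp del: eval.simps)
  qed
  then show ?thesis
    by (intro exI[of _ "Comp (Mu p) [Proj 0, Mu q]"]) blast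
qed

lemma infinite_column_reps:
  assumes R: "equiv UNIV R" and fin: "\<forall>C \<in> UNIV // R. finite C"
  shows "infinite (column_reps R n)"
proof
  assume fin_reps: "finite (column_reps R n)"
  have "\<exists>d\<in>column_reps R n. (prod_encode (n, d), prod_encode (n, j)) \<in> R" for j
  proof -
    define d where "d = (LEAST d. (prod_encode (n, d), prod_encode (n, j)) \<in> R)"
    have d: "(prod_encode (n, d), prod_encode (n, j)) \<in> R"
      unfolding d_def by (rule LeastI[of _ j]) (simp add: equiv_class_eq_iff[OF R])
    have "(prod_encode (n, i), prod_encode (n, d)) \<notin> R" if "i < d" for i
    proof
      assume "(prod_encode (n, i), prod_encode (n, d)) \<in> R"
      with d R have "(prod_encode (n, i), prod_encode (n, j)) \<in> R"
        by (meson equiv_def transD)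
      then show False
        using not_less_Least[OF that[unfolded d_def]] by blast
    qed
    with d show ?thesis by (auto simp: column_reps_def)
  qed
  then have "range (\<lambda>j. prod_encode (n, j)) \<subseteq>
      (\<Union>d\<in>column_reps R n. R `` {prod_encode (n, d)})"
    by auto
  moreover have "finite (\<Union>d\<in>column_reps R n. R `` {prod_encode (n, d)})"
    using fin_reps fin by (auto intro: quotientI)
  ultimately have "finite (range (\<lambda>j. prod_encode (n, j)))"
    by (rule finite_subset)
  then show False
    by (auto dest!: finite_imageD simp: inj_on_def)
qed

lemma exceeds_column_reps:
  assumes "infinite (column_reps R n)"
  shows "\<exists>k. card (column_reps R n \<inter> {..<k}) > n"
proof -
  obtain S where S: "S \<subseteq> column_reps R n" "finite S" "card S = Suc n"
    using infinite_arbitrarily_large[OF assms] by blast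
  then have "S \<subseteq> {..<Suc (Max S)}"
    by (auto simp: less_Suc_eq_le)
  then obtain k where "S \<subseteq> {..<k}" ..
  with S have "card S \<le> card (column_reps R n \<inter> {..<k})"
    by (intro card_mono) auto
  with S(3) show ?thesis by (intro exI[of _ k]) simp
qed

lemma finite_column_segment:
  assumes "infinite (column_reps R n)"
  shows "finite (column_segment R n)"
proof -
  obtain b where b: "card (column_reps R n \<inter> {..<b}) > n"
    using exceeds_column_reps[OF assms] by blast
  have "k < b" if "card (column_reps R n \<inter> {..<k}) \<le> n" for k
  proof (rule ccontr)
    assume "\<not> k < b"
    then have "card (column_reps R n \<inter> {..<b}) \<le> card (column_reps R n \<inter> {..<k})"
      by (intro card_mono) auto
    with b that show False by simp
  qed
  then have "column_segment R n \<subseteq> (\<lambda>k. prod_encode (n, k)) ` {..<b}"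
    by (auto simp: column_segment_def)
  then show ?thesis
    by (rule finite_subset) simp
qed

lemma column_segment_avoids:
  assumes R: "equiv UNIV R" and inf: "infinite (column_reps R n)"
    and F: "finite F" "card F \<le> n"
  shows "\<exists>y\<in>column_segment R n. \<forall>z\<in>F. (z, y) \<notin> R"
proof (rule ccontr)
  assume contra: "\<not> ?thesis"
  define k where "k = (LEAST k. card (column_reps R n \<inter> {..<k}) > n)"
  have k: "card (column_reps R n \<inter> {..<k}) > n"
    unfolding k_def using exceeds_column_reps[OF inf] by (rule LeastI_ex)
  have "prod_encode (n, j) \<in> column_segment R n" if "j < k" for j
    using not_less_Least[OF that[unfolded k_def]] by (auto simp: column_segment_def)
  with contra have "\<forall>j\<in>column_reps R n \<inter> {..<k}. \<exists>z\<in>F. (z, prod_encode (n, j)) \<in> R"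
    by blast
  then obtain g where g: "\<And>j. j \<in> column_reps R n \<inter> {..<k} \<Longrightarrow>
      g j \<in> F \<and> (g j, prod_encode (n, j)) \<in> R"
    by metis
  have "inj_on g (column_reps R n \<inter> {..<k})"
  proof (rule linorder_inj_onI)
    fix i j assume ij: "i < j" "i \<in> column_reps R n \<inter> {..<k}" "j \<in> column_reps R n \<inter> {..<k}"
    show "g i \<noteq> g j"
    proof
      assume "g i = g j"
      then have "(prod_encode (n, i), prod_encode (n, j)) \<in> R"
        using g[OF ij(2)] g[OF ij(3)] R by (metis equiv_def symD transD)
      with ij show False by (auto simp: column_reps_def)
    qed
  qed auto
  then have "card (column_reps R n \<inter> {..<k}) \<le> card F"
    using g F(1) by (intro card_inj_on_le[of g]) auto
  with k F(2) show False by simp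
qed

lemma ex_choice_inequivalent:
  assumes "\<And>n F. finite F \<Longrightarrow> card F \<le> n \<Longrightarrow> \<exists>y\<in>V n. \<forall>z\<in>F. (z, y) \<notin> R"
  shows "\<exists>x. \<forall>n::nat. x n \<in> V n \<and> (\<forall>m<n. (x m, x n) \<notin> R)"
proof (rule dependent_wellorder_choice)
  fix n and x :: "nat \<Rightarrow> 'a"
  have "card (x ` {..<n}) \<le> n"
    using card_image_le[of "{..<n}" x] by simp
  with assms[of "x ` {..<n}" n] show "\<exists>y. y \<in> V n \<and> (\<forall>m<n. (x m, y) \<notin> R)"
    by auto
qed auto

lemma ex_transversal_not_hyperhyperimmune:
  assumes R: "ceer R" and fin: "\<forall>C \<in> UNIV // R. finite C"
  shows "\<exists>T. transversal R T \<and> infinite T \<and> \<not> hyperhyperimmune T"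
proof -
  have equiv: "equiv UNIV R" and ce: "ce_rel R"
    using R by (auto simp: ceer_def)
  obtain c where c: "\<And>n. column_segment R n = {x. eval c [n, x] \<noteq> None}"
    using column_segment_ce[OF ce] by blast
  obtain f where f: "computable f" "\<And>n. W (f n) = column_segment R n"
    using computable_uniform_index[of c] unfolding c by blast
  note inf = infinite_column_reps[OF equiv fin]
  have array: "weak_disjoint_array f"
    unfolding weak_disjoint_array_def f(2)
    using f(1) finite_column_segment[OF inf] by (auto simp: column_segment_def)
  have "\<exists>x. \<forall>n. x n \<in> column_segment R n \<and> (\<forall>m<n. (x m, x n) \<notin> R)"
    by (intro ex_choice_inequivalent column_segment_avoids equiv inf)
  then obtain x where x: "\<And>n. x n \<in> column_segment R n" "\<And>m n. m < n \<Longrightarrow> (x m, x n) \<notin> R"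
    by auto
  have "W (f n) \<inter> range x \<noteq> {}" for n
    using x(1)[of n] f(2) by auto
  with array have "\<not> hyperhyperimmune (range x)"
    unfolding hyperhyperimmune_def by auto
  moreover have neq: "(x m, x n) \<notin> R" if "m \<noteq> n" for m n
  proof (cases "m < n")
    case False
    with that x(2)[of n m] show ?thesis
      using equiv by (auto simp: equiv_def dest: symD)
  qed (rule x(2))
  then have "transversal R (range x)"
    unfolding transversal_def by (metis rangeE)
  moreover have "inj x"
  proof (rule injI, rule ccontr)
    fix m n assume "x m = x n" "m \<noteq> n"
    with neq[of m n] show False
      by (simp add: equiv_class_eq_iff[OF equiv])
  qed
  then have "infinite (range x)"
    by (simp add: finite_image_iff)
  ultimately show ?thesis by blast
qed

theorem theorem2p10:
  shows "\<not> (\<exists>R. hyperhyperdark R \<and> (\<forall>C \<in> UNIV // R. finite C)) \<and>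
         (\<forall>R. ceer R \<and> (\<forall>C \<in> UNIV // R. finite C) \<longrightarrow>
           (\<exists>T. transversal R T \<and> infinite T \<and> \<not> hyperhyperimmune T))"
  using ex_transversal_not_hyperhyperimmune unfolding hyperhyperdark_def by blast

end
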